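(* Let $\mathcal{A}$ be a $C^*$-algebra with unit $1$, let $n\ge2$, let $(P_1,\dots,P_n)$ be a complete $n$-tuple of non-trivial projections in $\mathcal{A}$, put $A=\sum_{i=1}^nP_i$ (which is invertible in $\mathcal{A}$) and $Q_i=A^{-1/2}P_iA^{-1/2}$, $i=1,\dots,n$ (which are mutually orthogonal projections with sum $1$). Let $i_1<i_2<\cdots<i_k$ be elements of $\{1,\dots,n\}$ and let $\{j_1,\dots,j_l\}=\{1,\dots,n\}\setminus\{i_1,\dots,i_k\}$ with $j_1<\cdots<j_l$. Then $$P_{i_1}\vee\cdots\vee P_{i_k}=A^{1/2}\Big[\Big(\sum_{r=1}^kQ_{i_r}\Big)A\Big(\sum_{r=1}^kQ_{i_r}\Big)\Big]^{-1}A^{1/2}$$ and $$P_{i_1}\vee\cdots\vee P_{i_k}=\Big(\sum_{r=1}^kP_{i_r}\Big)\Big[\Big(\sum_{r=1}^kP_{i_r}\Big)^2+\sum_{t=1}^lP_{j_t}\Big]^{-1}\Big(\sum_{r=1}^kP_{i_r}\Big),$$ where in the first formula the inverse is taken in the corner algebra $Q_0\mathcal{A}Q_0$ with $Q_0=\sum_{r=1}^kQ_{i_r}$, and in the second formula the inverse is taken in $\mathcal{A}$.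
   Context: A projection in $\mathcal{A}$ is an element $P$ with $P=P^*=P^2$; it is non-trivial if $P\ne0$ and $P\ne1$. An $n$-tuple $(P_1,\dots,P_n)$ of non-trivial projections in $\mathcal{A}$ is called complete if $\mathcal{A}$ is the linear (algebraic) direct sum of the subspaces $P_i\mathcal{A}=\{P_ix:x\in\mathcal{A}\}$, $i=1,\dots,n$. For a positive element $B\in\mathcal{A}$ that is either invertible or has $0$ as an isolated point of its spectrum, $B^\dagger$ denotes its Moore--Penrose inverse: the unique positive element of $\mathcal{A}$ with $BB^\dagger B=B$, $B^\dagger BB^\dagger=B^\dagger$, $BB^\dagger=B^\dagger B$ (equal to $B^{-1}$ if $B$ is invertible). For a complete tuple and indices $i_1<\cdots<i_k$, the element $A_0=\sum_{r=1}^kP_{i_r}$ has this property, and $P_{i_1}\vee\cdots\vee P_{i_k}$ is defined to be the projection $A_0^\dagger A_0\in\mathcal{A}$; it is the smallest projection of $\mathcal{A}$ dominating all $P_{i_r}$, $r=1,\dots,k$. *)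

theory Defs
  imports Complex_Main "HOL-Library.FuncSet"
begin

text \<open>
  Unital complex \<open>C\<^sup>*\<close>-algebras. The superclass \<^class>\<open>real_normed_algebra_1\<close> includes
  \<open>0 \<noteq> 1\<close> and \<open>norm 1 = 1\<close>; the latter holds in every nonzero unital \<open>C\<^sup>*\<close>-algebra.
  The law \<open>scaleC 1 x = x\<close> is the case \<open>r = 1\<close> of \<open>scaleR_scaleC\<close>.
\<close>

class cstar_algebra = real_normed_algebra_1 + banach +
  fixes scaleC :: "complex \<Rightarrow> 'a \<Rightarrow> 'a" (infixr "*\<^sub>C" 75)
    and star :: "'a \<Rightarrow> 'a"
  assumes scaleR_scaleC: "r *\<^sub>R x = complex_of_real r *\<^sub>C x"
    and scaleC_add_right: "c *\<^sub>C (x + y) = c *\<^sub>C x + c *\<^sub>C y"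
    and scaleC_add_left: "(c + d) *\<^sub>C x = c *\<^sub>C x + d *\<^sub>C x"
    and scaleC_scaleC: "c *\<^sub>C (d *\<^sub>C x) = (c * d) *\<^sub>C x"
    and mult_scaleC_left: "(c *\<^sub>C x) * y = c *\<^sub>C (x * y)"
    and mult_scaleC_right: "x * (c *\<^sub>C y) = c *\<^sub>C (x * y)"
    and norm_scaleC: "norm (c *\<^sub>C x) = cmod c * norm x"
    and star_add: "star (x + y) = star x + star y"
    and star_scaleC: "star (c *\<^sub>C x) = cnj c *\<^sub>C star x"
    and star_mult: "star (x * y) = star y * star x"
    and star_star: "star (star x) = x"
    and cstar_identity: "norm (star x * x) = (norm x)\<^sup>2"

definition invertible_elt :: "'a::cstar_algebra \<Rightarrow> bool" where
  "invertible_elt x \<longleftrightarrow> (\<exists>y. x * y = 1 \<and> y * x = 1)"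

definition alg_inverse :: "'a::cstar_algebra \<Rightarrow> 'a" where
  "alg_inverse x = (THE y. x * y = 1 \<and> y * x = 1)"

definition alg_spectrum :: "'a::cstar_algebra \<Rightarrow> complex set" where
  "alg_spectrum x = {c. \<not> invertible_elt (x - c *\<^sub>C 1)}"

definition positive_elt :: "'a::cstar_algebra \<Rightarrow> bool" where
  "positive_elt x \<longleftrightarrow> star x = x \<and> alg_spectrum x \<subseteq> complex_of_real ` {0..}"

definition alg_sqrt :: "'a::cstar_algebra \<Rightarrow> 'a" where
  "alg_sqrt x = (THE y. positive_elt y \<and> y * y = x)"

text \<open>The corner algebra \<open>e \<A> e\<close> of a projection \<open>e\<close> has unit \<open>e\<close>.\<close>

definition corner :: "'a::cstar_algebra \<Rightarrow> 'a set" where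
  "corner e = range (\<lambda>x. e * x * e)"

definition corner_invertible :: "'a::cstar_algebra \<Rightarrow> 'a \<Rightarrow> bool" where
  "corner_invertible e x \<longleftrightarrow> x \<in> corner e \<and> (\<exists>y\<in>corner e. x * y = e \<and> y * x = e)"

definition corner_inverse :: "'a::cstar_algebra \<Rightarrow> 'a \<Rightarrow> 'a" where
  "corner_inverse e x = (THE y. y \<in> corner e \<and> x * y = e \<and> y * x = e)"

definition is_projection :: "'a::cstar_algebra \<Rightarrow> bool" where
  "is_projection p \<longleftrightarrow> star p = p \<and> p * p = p"

definition nontrivial_projection :: "'a::cstar_algebra \<Rightarrow> bool" where
  "nontrivial_projection p \<longleftrightarrow> is_projection p \<and> p \<noteq> 0 \<and> p \<noteq> 1"

text \<open>
  The whole algebra is the algebraic direct sum of the subspaces \<open>V i\<close>, \<open>i \<in> S\<close>: every element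
  has exactly one family of components. Components are taken in the extensional product, so that
  uniqueness concerns only the indices in \<open>S\<close>.
\<close>

definition is_direct_sum :: "nat set \<Rightarrow> (nat \<Rightarrow> 'a::cstar_algebra set) \<Rightarrow> bool" where
  "is_direct_sum S V \<longleftrightarrow> (\<forall>x. \<exists>!y. y \<in> (\<Pi>\<^sub>E i\<in>S. V i) \<and> x = (\<Sum>i\<in>S. y i))"

definition complete_tuple :: "nat \<Rightarrow> (nat \<Rightarrow> 'a::cstar_algebra) \<Rightarrow> bool" where
  "complete_tuple n P \<longleftrightarrow>
     (\<forall>i\<in>{1..n}. nontrivial_projection (P i)) \<and>
     is_direct_sum {1..n} (\<lambda>i. range (\<lambda>x. P i * x))"

text \<open>
  Only meaningful for positive \<open>b\<close> that is invertible or has \<open>0\<close> as an isolated point of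
  its spectrum.
\<close>

definition moore_penrose :: "'a::cstar_algebra \<Rightarrow> 'a" where
  "moore_penrose b =
     (THE y. positive_elt y \<and> b * y * b = b \<and> y * b * y = y \<and> b * y = y * b)"

definition proj_join :: "(nat \<Rightarrow> 'a::cstar_algebra) \<Rightarrow> nat set \<Rightarrow> 'a" where
  "proj_join P S = moore_penrose (\<Sum>i\<in>S. P i) * (\<Sum>i\<in>S. P i)"

end

theory Submission
  imports Defs "HOL-Analysis.Elementary_Metric_Spaces"
begin

text \<open>
  The components \<open>E\<^sub>i\<close> of 1 in the direct sum are idempotents with \<open>E\<^sub>i P\<^sub>j = \<delta>\<^sub>i\<^sub>j P\<^sub>j\<close>, so \<open>E\<^sub>i A = P\<^sub>i\<close> and
  \<open>A\<^sup>-\<^sup>1\<close> is the sum of the \<open>E\<^sub>i\<^sup>* E\<^sub>i\<close>. For a set \<open>I\<close> of indices, let \<open>e\<close> and \<open>B\<close> be the sums of the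
  \<open>E\<^sub>i\<close> and the \<open>P\<^sub>i\<close> over \<open>I\<close>. Then \<open>B = eA = Ae\<^sup>*\<close>, and the join is the range projection \<open>F\<close> of the
  idempotent \<open>e\<close>, namely \<open>F = e(e + e\<^sup>* - 1)\<^sup>-\<^sup>1\<close>; the Moore--Penrose inverse of \<open>B\<close> is \<open>F A\<^sup>-\<^sup>1 F\<close>. Both
  formulas become ring identities in \<open>A\<close>, \<open>e\<close> and \<open>F\<close>.

  Positivity is handled without Gelfand theory: a self-adjoint element is invertible with spectrum in
  \<open>[0,\<infinity>)\<close> iff it lies in an open disc \<open>\<parallel>c - x\<parallel> < c\<close>, iff it is the square of a self-adjoint
  invertible element.
\<close>

section \<open>Invertible and positive elements\<close>

lemma star_0 [simp]: "star (0::'a::cstar_algebra) = 0"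
  using star_add [of "0::'a" 0] by simp

lemma star_minus: "star (- x) = - star (x::'a::cstar_algebra)"
  using star_add [of x "- x"] by (simp add: add_eq_0_iff2)

lemma star_diff: "star (x - y) = star x - star (y::'a::cstar_algebra)"
  using star_add [of x "- y"] by (simp add: star_minus)

lemma star_1 [simp]: "star (1::'a::cstar_algebra) = 1"
  by (metis star_mult star_star mult_1_left mult_1_right)

lemma star_scaleR: "star (r *\<^sub>R x) = r *\<^sub>R star (x::'a::cstar_algebra)"
  by (simp add: scaleR_scaleC star_scaleC)

lemma star_sum: "star (\<Sum>i\<in>S. f i) = (\<Sum>i\<in>S. star (f i :: 'a::cstar_algebra))"
  by (induction S rule: infinite_finite_induct) (simp_all add: star_add)

lemma norm_star [simp]: "norm (star x) = norm (x::'a::cstar_algebra)"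
proof -
  have *: "norm x \<le> norm (star x)" for x :: 'a
  proof (cases "norm x = 0")
    case False
    have "norm x * norm x \<le> norm (star x) * norm x"
      using norm_mult_ineq [of "star x" x] by (simp add: cstar_identity power2_eq_square)
    with False show ?thesis
      by (simp add: mult_le_cancel_right)
  qed simp
  show ?thesis
    using * [of x] * [of "star x"] by (simp add: star_star)
qed

lemma continuous_on_star: "continuous_on S (star :: 'a::cstar_algebra \<Rightarrow> 'a)"
  by (auto simp: continuous_on_iff dist_norm simp flip: star_diff)

lemma scaleC_0_left: "0 *\<^sub>C (x::'a::cstar_algebra) = 0"
  using scaleR_scaleC [of 0 x] by simp

lemma scaleC_1: "1 *\<^sub>C (x::'a::cstar_algebra) = x"
  using scaleR_scaleC [of 1 x] by simp

lemma scaleC_minus_left: "(- c) *\<^sub>C (x::'a::cstar_algebra) = - (c *\<^sub>C x)"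
  using scaleC_add_left [of c "- c" x] by (simp add: scaleC_0_left add_eq_0_iff2)

lemma scaleC_diff_right: "c *\<^sub>C (x - y) = c *\<^sub>C x - c *\<^sub>C (y::'a::cstar_algebra)"
  using scaleC_add_right [of c "x - y" y] by simp

section \<open>Inverses and invertibility near scalars\<close>

lemma cancel_inverse_left: "x * y = 1 \<Longrightarrow> x * (y * z) = (z::'a::monoid_mult)"
  by (metis mult.assoc mult_1_left)

text \<open>Multiplying \<open>z x = x z\<close> by the inverse on both sides gives the commutation
  clause, and uniqueness of inverses gives self-adjointness. Both are needed nearly every time an
  inverse is taken below.\<close>

lemma invertible_eltE:
  fixes x :: "'a::cstar_algebra"
  assumes "invertible_elt x"
  obtains y where "x * y = 1" "y * x = 1" "\<And>z. z * x = x * z \<Longrightarrow> z * y = y * z"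
    "star x = x \<Longrightarrow> star y = y"
proof -
  from assms obtain y where y: "x * y = 1" "y * x = 1"
    unfolding invertible_elt_def by auto
  have "z * y = y * z" if "z * x = x * z" for z
  proof -
    have "z * y = y * (x * z) * y"
      by (metis y(2) mult.assoc mult_1_left)
    also have "\<dots> = y * (z * x) * y"
      using that by simp
    also have "\<dots> = y * z * (x * y)"
      by (simp add: mult.assoc)
    finally show ?thesis using y by simp
  qed
  moreover have "star y = y" if "star x = x"
    using that y by (metis star_mult star_1 mult.assoc mult_1_left mult_1_right)
  ultimately show thesis using that y by blast
qed

lemma invertible_eltI: "x * y = 1 \<Longrightarrow> z * x = 1 \<Longrightarrow> invertible_elt (x::'a::cstar_algebra)"
  unfolding invertible_elt_def by (metis mult.assoc mult_1_left mult_1_right)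

text \<open>The adjoint of a right inverse is a left inverse.\<close>

lemma invertible_elt_selfadjointI:
  "star x = x \<Longrightarrow> x * y = 1 \<Longrightarrow> invertible_elt (x::'a::cstar_algebra)"
  by (rule invertible_eltI [of x y "star y"]) (metis star_mult star_1)+

lemma invertible_elt_mult:
  "invertible_elt x \<Longrightarrow> invertible_elt y \<Longrightarrow> invertible_elt (x * y :: 'a::cstar_algebra)"
proof (elim invertible_eltE)
  fix x' y' assume *: "x * x' = 1" "x' * x = 1" "y * y' = 1" "y' * y = 1"
  have "(x * y) * (y' * x') = x * (y * y') * x'" "(y' * x') * (x * y) = y' * (x' * x) * y"
    by (simp_all add: mult.assoc)
  with * show "invertible_elt (x * y)"
    by (intro invertible_eltI [of _ "y' * x'" "y' * x'"]) auto
qed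

lemma invertible_elt_scaleC:
  assumes "invertible_elt (x::'a::cstar_algebra)" "c \<noteq> 0"
  shows "invertible_elt (c *\<^sub>C x)"
proof -
  obtain y where "x * y = 1" "y * x = 1" using assms(1) by (rule invertible_eltE)
  then show ?thesis using assms(2)
    by (intro invertible_eltI [of _ "inverse c *\<^sub>C y" "inverse c *\<^sub>C y"])
       (auto simp: mult_scaleC_left mult_scaleC_right scaleC_scaleC scaleC_1)
qed

lemma alg_inverse_eq:
  "x * y = 1 \<Longrightarrow> y * x = 1 \<Longrightarrow> alg_inverse (x::'a::cstar_algebra) = y"
  unfolding alg_inverse_def by (rule the_equality) (auto, metis mult.assoc mult_1_left mult_1_right)

text \<open>In place of the Neumann series, a right and a left inverse arise as fixed points of the
  contractions \<open>y \<mapsto> 1 + (1 - x) y\<close> and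
  \<open>y \<mapsto> 1 + y (1 - x)\<close>.\<close>

lemma invertible_elt_near_1:
  fixes x :: "'a::cstar_algebra"
  assumes "norm (1 - x) < 1"
  shows "invertible_elt x"
proof -
  have "\<exists>!y. 1 + (1 - x) * y = y"
  proof (rule banach_fix_type [of "norm (1 - x)"]; (intro allI)?)
    fix y z show "dist (1 + (1 - x) * y) (1 + (1 - x) * z) \<le> norm (1 - x) * dist y z"
      using norm_mult_ineq [of "1 - x" "y - z"] by (simp add: dist_norm algebra_simps)
  qed (use assms in auto)
  moreover have "\<exists>!y. 1 + y * (1 - x) = y"
  proof (rule banach_fix_type [of "norm (1 - x)"]; (intro allI)?)
    fix y z show "dist (1 + y * (1 - x)) (1 + z * (1 - x)) \<le> norm (1 - x) * dist y z"
      using norm_mult_ineq [of "y - z" "1 - x"] by (simp add: dist_norm algebra_simps)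
  qed (use assms in auto)
  ultimately obtain y z where "1 + (1 - x) * y = y" "1 + z * (1 - x) = z"
    by blast
  then have "x * y = 1" "z * x = 1"
    by (auto simp: algebra_simps)
  then show ?thesis by (rule invertible_eltI)
qed

lemma invertible_elt_near_scalar:
  fixes x :: "'a::cstar_algebra"
  assumes "norm (c *\<^sub>C 1 - x) < cmod c"
  shows "invertible_elt x"
proof -
  have c: "c \<noteq> 0" using assms by auto
  have "1 - inverse c *\<^sub>C x = inverse c *\<^sub>C (c *\<^sub>C 1 - x)"
    using c by (simp add: scaleC_diff_right scaleC_scaleC scaleC_1)
  then have "norm (1 - inverse c *\<^sub>C x) = inverse (cmod c) * norm (c *\<^sub>C 1 - x)"
    by (simp add: norm_scaleC norm_inverse)
  also have "\<dots> < 1" using assms c by (simp add: field_simps)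
  finally have "invertible_elt (c *\<^sub>C (inverse c *\<^sub>C x))"
    using c by (intro invertible_elt_scaleC invertible_elt_near_1)
  then show ?thesis using c by (simp add: scaleC_scaleC scaleC_1)
qed

text \<open>Arens' trick: the imaginary shift by \<open>T\<close> costs only \<open>T\<^sup>2\<close> in the square of the norm.\<close>

lemma invertible_elt_selfadjoint_minus:
  fixes x :: "'a::cstar_algebra"
  assumes sa: "star x = x" and im: "Im c \<noteq> 0"
  shows "invertible_elt (x - c *\<^sub>C 1)"
proof -
  define h where "h = x - Re c *\<^sub>R 1"
  define b where "b = Im c"
  \<comment> \<open>This \<open>T\<close> makes \<open>2 * T * b\<close> equal to
    \<open>(norm h)\<^sup>2\<close>, so \<open>(norm h)\<^sup>2 + T\<^sup>2\<close> falls short of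
    \<open>(T + b)\<^sup>2\<close> by exactly \<open>b\<^sup>2\<close>.\<close>
  define T where "T = (norm h)\<^sup>2 / (2 * b)"
  have h: "star h = h" using sa by (simp add: h_def star_diff star_scaleR)
  have b: "b \<noteq> 0" using im by (simp add: b_def)
  define d where "d = Complex 0 (- (T + b))"
  have split: "c = complex_of_real (Re c) + Complex 0 b"
    by (simp add: b_def complex_eq_iff)
  have "d *\<^sub>C 1 - (x - c *\<^sub>C 1) = - (h + Complex 0 T *\<^sub>C 1)"
  proof -
    have c: "c *\<^sub>C (1::'a) = Re c *\<^sub>R 1 + Complex 0 b *\<^sub>C 1"
      by (subst split) (simp only: scaleC_add_left scaleR_scaleC)
    have d: "d *\<^sub>C (1::'a) = - (Complex 0 T *\<^sub>C 1) - Complex 0 b *\<^sub>C 1"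
    proof -
      have "d = - Complex 0 T + - Complex 0 b" by (simp add: d_def complex_eq_iff)
      then show ?thesis by (simp only: scaleC_add_left scaleC_minus_left) simp
    qed
    show ?thesis by (simp add: c d h_def)
  qed
  then have "(norm (d *\<^sub>C 1 - (x - c *\<^sub>C 1)))\<^sup>2 = (norm (h + Complex 0 T *\<^sub>C 1))\<^sup>2"
    by (simp only: norm_minus_cancel)
  also have "\<dots> = norm (star (h + Complex 0 T *\<^sub>C 1) * (h + Complex 0 T *\<^sub>C 1))"
    by (rule cstar_identity [symmetric])
  also have "star (h + Complex 0 T *\<^sub>C 1) * (h + Complex 0 T *\<^sub>C 1) = h * h + (T\<^sup>2) *\<^sub>R 1"
  proof -
    have "cnj (Complex 0 T) = - Complex 0 T" "Complex 0 T * Complex 0 T = - complex_of_real (T\<^sup>2)"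
      by (simp_all add: complex_eq_iff power2_eq_square)
    then show ?thesis
      by (simp add: star_add star_scaleC h scaleC_minus_left algebra_simps mult_scaleC_left
          mult_scaleC_right scaleC_scaleC scaleC_add_right scaleC_diff_right scaleR_scaleC)
  qed
  also have "norm \<dots> \<le> (norm h)\<^sup>2 + T\<^sup>2"
    using norm_triangle_ineq [of "h * h" "T\<^sup>2 *\<^sub>R 1"] norm_mult_ineq [of h h]
    by (simp add: power2_eq_square)
  also have "\<dots> < (T + b)\<^sup>2"
  proof -
    have "2 * T * b = (norm h)\<^sup>2" using b by (simp add: T_def)
    moreover have "0 < b\<^sup>2" using b by simp
    ultimately show ?thesis by (simp add: power2_sum)
  qed
  also have "\<dots> = (cmod d)\<^sup>2" by (simp only: d_def cmod_power2) (simp add: power2_eq_square algebra_simps)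
  finally have "norm (d *\<^sub>C 1 - (x - c *\<^sub>C 1)) < cmod d"
    by (rule power_less_imp_less_base) simp
  then show ?thesis by (rule invertible_elt_near_scalar)
qed

section \<open>Positivity by norm estimates\<close>

text \<open>Spectral values are real by self-adjointness. For \<open>r < 0\<close>, the distance
  from \<open>c - r\<close> to \<open>x - r\<close> is still at most \<open>c\<close>, which is less
  than \<open>c - r\<close>, so \<open>x - r\<close> is invertible.\<close>

lemma positive_eltI:
  fixes x :: "'a::cstar_algebra"
  assumes sa: "star x = x" and c: "norm (c *\<^sub>R 1 - x) \<le> c"
  shows "positive_elt x"
  unfolding positive_elt_def alg_spectrum_def
proof (intro conjI sa subsetI)
  fix z assume "z \<in> {z. \<not> invertible_elt (x - z *\<^sub>C 1)}"
  then have z: "\<not> invertible_elt (x - z *\<^sub>C 1)" by simp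
  then have "Im z = 0" using invertible_elt_selfadjoint_minus [OF sa] by blast
  then obtain r where r: "z = complex_of_real r"
    by (metis Reals_cases complex_is_Real_iff)
  have "0 \<le> r"
  proof (rule ccontr)
    assume "\<not> 0 \<le> r"
    have "0 \<le> c" using c norm_ge_zero order_trans by blast
    have "complex_of_real (c - r) *\<^sub>C 1 - (x - z *\<^sub>C 1) = c *\<^sub>R 1 - x"
      unfolding r scaleR_scaleC [symmetric] by (simp add: algebra_simps)
    moreover have "c < cmod (complex_of_real (c - r))"
      using \<open>\<not> 0 \<le> r\<close> \<open>0 \<le> c\<close> by (simp only: norm_of_real)
    ultimately show False
      using z c invertible_elt_near_scalar [of "complex_of_real (c - r)" "x - z *\<^sub>C 1"]
      by (metis le_less_trans)
  qed
  then show "z \<in> complex_of_real ` {0..}" using r by auto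
qed

text \<open>A norm condition that stands in for being positive and invertible;
  \<open>positive_invertible_imp_strictly_positive\<close> completes the equivalence. Unlike a
  statement about the spectrum, it can be checked by the triangle inequality.\<close>

definition strictly_positive :: "'a::cstar_algebra \<Rightarrow> bool" where
  "strictly_positive x \<longleftrightarrow> star x = x \<and> (\<exists>c>0. norm (c *\<^sub>R 1 - x) < c)"

lemma strictly_positive_imp_positive: "strictly_positive x \<Longrightarrow> positive_elt x"
  unfolding strictly_positive_def by (blast intro: positive_eltI less_imp_le)

lemma strictly_positive_invertible: "strictly_positive x \<Longrightarrow> invertible_elt x"
  unfolding strictly_positive_def
  by (metis invertible_elt_near_scalar scaleR_scaleC norm_of_real abs_of_pos)

lemma strictly_positive_scaleR:
  assumes "strictly_positive (x::'a::cstar_algebra)" "r > 0"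
  shows "strictly_positive (r *\<^sub>R x)"
proof -
  obtain c where c: "c > 0" "norm (c *\<^sub>R 1 - x) < c" "star x = x"
    using assms unfolding strictly_positive_def by auto
  have "norm ((r * c) *\<^sub>R 1 - r *\<^sub>R x) = r * norm (c *\<^sub>R 1 - x)"
    using assms by (simp flip: scaleR_scaleR scaleR_diff_right)
  then show ?thesis unfolding strictly_positive_def
    using assms c by (intro conjI exI [of _ "r * c"]) (auto simp: star_scaleR)
qed

section \<open>Square roots\<close>

text \<open>With \<open>s = 1 - y\<close>, the equation \<open>s\<^sup>2 = x\<close> becomes the fixed point equation
  \<open>y = ((1 - x) + y\<^sup>2) / 2\<close>, a contraction of a ball of radius less than 1.\<close>

lemma sqrt_near_1:
  fixes x :: "'a::cstar_algebra"
  assumes sa: "star x = x" and near: "norm (1 - x) < 1"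
  shows "\<exists>s. star s = s \<and> s * s = x \<and> norm (1 - s) < 1 \<and> (\<forall>z. z * x = x * z \<longrightarrow> z * s = s * z)"
proof -
  define r where "r = norm (1 - x)"
  have r: "0 \<le> r" "r < 1" using near by (auto simp: r_def)
  \<comment> \<open>Self-adjointness and commutation with whatever commutes with \<open>x\<close>
    are closed conditions; built into the domain, they pass to the fixed point.\<close>
  define S where "S = cball 0 r \<inter> {y. star y = y} \<inter> {y. \<forall>z. z * x = x * z \<longrightarrow> z * y = y * z}"
  define f where "f = (\<lambda>y. (1/2) *\<^sub>R ((1 - x) + y * y))"
  have "closed S" unfolding S_def
  proof (intro closed_Int closed_Collect_all)
    show "closed {y. star y = y}"
      by (intro closed_Collect_eq continuous_on_star continuous_on_id)
    show "closed {y. z * x = x * z \<longrightarrow> z * y = y * z}" for z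
      by (cases "z * x = x * z") (auto intro!: closed_Collect_eq continuous_intros)
  qed auto
  moreover have "S \<noteq> {}" using r by (auto simp: S_def set_eq_iff intro!: exI [of _ 0])
  moreover have "f ` S \<subseteq> S"
  proof (intro image_subsetI)
    fix y assume y: "y \<in> S"
    then have yr: "norm y \<le> r" by (simp add: S_def)
    have "norm (f y) \<le> (1/2) * (r + norm (y * y))"
      unfolding f_def r_def using norm_triangle_ineq [of "1 - x" "y * y"] by simp
    also have "norm (y * y) \<le> r * r"
      by (rule order_trans [OF norm_mult_ineq mult_mono]) (use yr r in auto)
    also have "r * r \<le> r" using r by (simp add: mult_left_le)
    finally have "norm (f y) \<le> r" by simp
    moreover have "star (f y) = f y"
    proof -
      have "star y = y" using y by (simp add: S_def)
      then show ?thesis by (simp add: sa f_def star_scaleR star_add star_diff star_mult)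
    qed
    moreover have "z * f y = f y * z" if "z * x = x * z" for z
    proof -
      have "z * y = y * z" using y that by (auto simp: S_def)
      then have "z * (y * y) = (y * y) * z" by (metis mult.assoc)
      then show ?thesis using that by (simp add: f_def algebra_simps)
    qed
    ultimately show "f y \<in> S" by (auto simp: S_def)
  qed
  moreover have "dist (f y) (f z) \<le> r * dist y z" if "y \<in> S" "z \<in> S" for y z
  proof -
    have "f y - f z = (1/2) *\<^sub>R (y * (y - z) + (y - z) * z)"
      by (simp add: f_def algebra_simps)
    then have "norm (f y - f z) \<le> (1/2) * (norm (y * (y - z)) + norm ((y - z) * z))"
      using norm_triangle_ineq by simp
    also have "norm (y * (y - z)) \<le> r * norm (y - z)"
      by (rule order_trans [OF norm_mult_ineq mult_right_mono]) (use that in \<open>auto simp: S_def\<close>)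
    also have "norm ((y - z) * z) \<le> norm (y - z) * r"
      by (rule order_trans [OF norm_mult_ineq mult_left_mono]) (use that in \<open>auto simp: S_def\<close>)
    finally show ?thesis by (simp add: dist_norm mult.commute)
  qed
  ultimately have "\<exists>!y\<in>S. f y = y"
    using r by (intro Banach_fix [of S r f]) (auto simp: complete_eq_closed)
  then obtain y where y: "y \<in> S" "f y = y" by blast
  have "2 *\<^sub>R y = 2 *\<^sub>R f y" using y by simp
  then have "y + y = (1 - x) + y * y" by (simp add: f_def scaleR_2)
  then have "(1 - y) * (1 - y) = x" by (simp add: algebra_simps)
  moreover have "z * (1 - y) = (1 - y) * z" if "z * x = x * z" for z
    using y that by (auto simp: S_def algebra_simps)
  moreover have "norm (1 - (1 - y)) < 1" "star (1 - y) = 1 - y"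
    using y r by (auto simp: S_def star_diff)
  ultimately show ?thesis by blast
qed

lemma strictly_positive_sqrt:
  fixes x :: "'a::cstar_algebra"
  assumes "strictly_positive x"
  shows "\<exists>s. strictly_positive s \<and> s * s = x \<and> (\<forall>z. z * x = x * z \<longrightarrow> z * s = s * z)"
proof -
  obtain c where c: "c > 0" "norm (c *\<^sub>R 1 - x) < c" "star x = x"
    using assms unfolding strictly_positive_def by auto
  define y where "y = (1/c) *\<^sub>R x"
  have "norm (1 - y) = norm ((1/c) *\<^sub>R (c *\<^sub>R 1 - x))"
    using c by (simp add: y_def scaleR_diff_right)
  also have "\<dots> = (1/c) * norm (c *\<^sub>R 1 - x)" using c by simp
  also have "\<dots> < 1" using c by simp
  finally have y: "norm (1 - y) < 1" "star y = y"
    using c by (simp_all add: y_def star_scaleR)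
  from sqrt_near_1 [OF y(2,1)] obtain s where s: "star s = s" "s * s = y" "norm (1 - s) < 1"
    "\<And>z. z * y = y * z \<Longrightarrow> z * s = s * z" by blast
  have "strictly_positive (sqrt c *\<^sub>R s)"
    using c s(1,3) by (intro strictly_positive_scaleR) (auto simp: strictly_positive_def intro!: exI [of _ 1])
  moreover have "(sqrt c *\<^sub>R s) * (sqrt c *\<^sub>R s) = x"
    using c s(2) by (simp add: y_def)
  moreover have "z * (sqrt c *\<^sub>R s) = (sqrt c *\<^sub>R s) * z" if "z * x = x * z" for z
    using s(4) [of z] that by (simp add: y_def)
  ultimately show ?thesis by (intro exI [of _ "sqrt c *\<^sub>R s"]) simp
qed

text \<open>With \<open>v\<close> a square root of \<open>2c - h\<^sup>2\<close>, the element \<open>u = h + iv\<close> satisfies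
  \<open>u\<^sup>*u = 2c\<close>, and \<open>4(h\<^sup>2 - c) = u\<^sup>2 + (u\<^sup>*)\<^sup>2\<close>.\<close>

lemma norm_scalar_minus_square:
  fixes h :: "'a::cstar_algebra"
  assumes sa: "star h = h" and c: "norm (h * h) < 2 * c"
  shows "norm (c *\<^sub>R 1 - h * h) \<le> c"
proof -
  have "0 < 2 * c" using c norm_ge_zero le_less_trans by blast
  then have "strictly_positive ((2 * c) *\<^sub>R 1 - h * h)"
    unfolding strictly_positive_def using c sa
    by (intro conjI exI [of _ "2 * c"]) (auto simp: star_diff star_scaleR star_mult)
  from strictly_positive_sqrt [OF this] obtain v where
    v: "star v = v" "v * v = (2 * c) *\<^sub>R 1 - h * h"
      "\<And>z. z * (h * h) = (h * h) * z \<Longrightarrow> z * v = v * z"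
    unfolding strictly_positive_def by (auto simp: algebra_simps)
  have hv: "h * v = v * h" by (rule v(3)) (simp add: mult.assoc)
  define u where "u = h + \<i> *\<^sub>C v"
  have su: "star u = h - \<i> *\<^sub>C v"
    by (simp add: u_def star_add star_scaleC sa v(1) scaleC_minus_left)
  have i2: "\<i> *\<^sub>C \<i> *\<^sub>C z = - z" for z :: 'a
    using scaleC_minus_left [of 1 z] by (simp add: scaleC_scaleC scaleC_1)
  have "(norm u)\<^sup>2 = norm (star u * u)" by (rule cstar_identity [symmetric])
  also have "star u * u = (2 * c) *\<^sub>R 1"
    unfolding su unfolding u_def
    by (simp add: algebra_simps mult_scaleC_left mult_scaleC_right scaleC_diff_right
        scaleC_add_right hv i2 v(2))
  finally have nu: "(norm u)\<^sup>2 = 2 * c" using \<open>0 < 2 * c\<close> by simp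
  have "(4::real) *\<^sub>R (c *\<^sub>R 1 - h * h) = - (u * u + star u * star u)"
  proof -
    have "u * u + star u * star u = 2 *\<^sub>R (h * h) - 2 *\<^sub>R (v * v)"
      unfolding su unfolding u_def
      by (simp add: algebra_simps mult_scaleC_left mult_scaleC_right scaleC_diff_right
          scaleC_add_right i2 scaleR_2)
    also have "\<dots> = - (4 *\<^sub>R (c *\<^sub>R 1 - h * h))"
      by (simp add: v(2) algebra_simps flip: scaleR_add_left)
    finally show ?thesis by simp
  qed
  then have "4 * norm (c *\<^sub>R 1 - h * h) = norm (u * u + star u * star u)"
    by (metis norm_minus_cancel norm_scaleR abs_numeral)
  also have "\<dots> \<le> (norm u)\<^sup>2 + (norm u)\<^sup>2"
    using norm_triangle_ineq [of "u * u" "star u * star u"] norm_mult_ineq [of u u]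
      norm_mult_ineq [of "star u" "star u"] by (simp add: power2_eq_square)
  finally show ?thesis using nu by simp
qed

section \<open>Squares, products and inverses of strictly positive elements\<close>

text \<open>For small \<open>e > 0\<close>, also \<open>w\<^sup>2 - e\<close> is a square, namely of
  \<open>w r\<close> with \<open>r\<close> a root of \<open>1 - e w\<^sup>-\<^sup>2\<close>. So
  \<open>norm_scalar_minus_square\<close> puts it into a closed disc of centre and radius
  \<open>c\<close>, and \<open>w\<^sup>2\<close> is in the open disc of centre and radius
  \<open>c + e\<close>.\<close>

lemma strictly_positive_square:
  fixes w :: "'a::cstar_algebra"
  assumes sa: "star w = w" and inv: "invertible_elt w"
  shows "strictly_positive (w * w)"
proof -
  obtain v where v: "w * v = 1" "v * w = 1" "star v = v" "\<And>z. z * w = w * z \<Longrightarrow> z * v = v * z"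
    using inv sa by (metis invertible_eltE)
  \<comment> \<open>Small enough to bring \<open>1 - e *\<^sub>R (v * v)\<close> within the reach of
    \<open>sqrt_near_1\<close>.\<close>
  define e where "e = 1 / (norm (v * v) + 1)"
  have e: "e > 0" by (simp add: e_def add_nonneg_pos)
  have "e * norm (v * v) < 1" by (simp add: e_def add_nonneg_pos)
  then have "norm (1 - (1 - e *\<^sub>R (v * v))) < 1" using e by simp
  moreover have "star (1 - e *\<^sub>R (v * v)) = 1 - e *\<^sub>R (v * v)"
    by (simp add: star_diff star_scaleR star_mult v(3))
  ultimately obtain r where r: "star r = r" "r * r = 1 - e *\<^sub>R (v * v)"
     "\<And>z. z * (1 - e *\<^sub>R (v * v)) = (1 - e *\<^sub>R (v * v)) * z \<Longrightarrow> z * r = r * z"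
    using sqrt_near_1 [of "1 - e *\<^sub>R (v * v)"] by blast
  have wvv: "w * (v * v) = v" "v * v * w = v" using v(1,2) by (simp_all add: cancel_inverse_left mult.assoc)
  have wr: "w * r = r * w" by (rule r(3)) (simp add: left_diff_distrib right_diff_distrib wvv)
  have "(w * r) * (w * r) = w * (r * r) * w"
    using wr by (metis mult.assoc)
  also have "\<dots> = w * w - e *\<^sub>R 1"
    using v(1,2) by (simp add: r(2) right_diff_distrib left_diff_distrib wvv mult.assoc)
  finally have sq: "(w * r) * (w * r) = w * w - e *\<^sub>R 1" .
  define c where "c = norm (w * w - e *\<^sub>R 1) + 1"
  have "norm (c *\<^sub>R 1 - (w * r) * (w * r)) \<le> c"
  proof (rule norm_scalar_minus_square)
    show "star (w * r) = w * r" by (simp add: star_mult sa r(1) wr)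
    show "norm ((w * r) * (w * r)) < 2 * c"
      unfolding sq c_def using norm_ge_zero [of "w * w - e *\<^sub>R 1"]
      by (simp only: distrib_left)
  qed
  then have "norm ((c + e) *\<^sub>R 1 - w * w) \<le> c"
    unfolding sq by (simp add: algebra_simps)
  moreover have "0 < c" by (simp add: c_def add_nonneg_pos)
  ultimately show ?thesis
    unfolding strictly_positive_def using e sa
    by (intro conjI exI [of _ "c + e"]) (auto simp: star_mult)
qed

text \<open>Each root commutes with whatever its square commutes with, so \<open>s\<close> and
  \<open>t\<close> commute and \<open>x * y\<close> is the square of the self-adjoint invertible
  \<open>s * t\<close>.\<close>

lemma strictly_positive_mult:
  fixes x y :: "'a::cstar_algebra"
  assumes "strictly_positive x" "strictly_positive y" "x * y = y * x"
  shows "strictly_positive (x * y)"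
proof -
  from strictly_positive_sqrt [OF assms(1)] obtain s where
    s: "strictly_positive s" "s * s = x" "\<And>z. z * x = x * z \<Longrightarrow> z * s = s * z" by blast
  from strictly_positive_sqrt [OF assms(2)] obtain t where
    t: "strictly_positive t" "t * t = y" "\<And>z. z * y = y * z \<Longrightarrow> z * t = t * z" by blast
  have "s * t = t * s" using s(3) t(3) assms(3) by metis
  then have "(s * t) * (s * t) = x * y" "star (s * t) = s * t"
    using s t unfolding strictly_positive_def by (metis mult.assoc, metis star_mult)
  then show ?thesis
    using strictly_positive_square [of "s * t"] s t
    by (metis invertible_elt_mult strictly_positive_invertible)
qed

text \<open>\<open>y = x y\<^sup>2\<close> is a product of commuting strictly positive
  elements.\<close>

lemma strictly_positive_inverse:
  fixes x y :: "'a::cstar_algebra"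
  assumes "strictly_positive x" and y: "x * y = 1" "y * x = 1"
  shows "strictly_positive y"
proof -
  have sa: "star y = y" using assms unfolding strictly_positive_def
    by (metis star_mult star_1 mult.assoc mult_1_left mult_1_right)
  have "invertible_elt y" using y invertible_eltI by blast
  then have "strictly_positive (y * y)" using sa by (rule strictly_positive_square [rotated])
  then have "strictly_positive (x * (y * y))"
    using assms by (intro strictly_positive_mult [of x "y * y"]) (simp_all add: cancel_inverse_left mult.assoc)
  moreover have "x * (y * y) = y" using y by (simp add: cancel_inverse_left)
  ultimately show ?thesis by simp
qed

text \<open>Let \<open>m\<close> be the infimum of the shifts \<open>t \<ge> 0\<close> for which \<open>x + t\<close> is strictly positive. As
  \<open>x + m\<close> is invertible, nearby shifts are strictly positive together with \<open>x + m\<close>, so the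
  infimum is attained and is \<open>0\<close>.\<close>

lemma positive_invertible_imp_strictly_positive:
  fixes x :: "'a::cstar_algebra"
  assumes pos: "positive_elt x" and inv: "invertible_elt x"
  shows "strictly_positive x"
proof -
  have sa: "star x = x" using pos by (simp add: positive_elt_def)
  define T where "T = {t. 0 \<le> t \<and> strictly_positive (x + t *\<^sub>R 1)}"
  have up: "t' \<in> T" if t: "t \<in> T" "t \<le> t'" for t t'
  proof -
    obtain c where c: "c > 0" "norm (c *\<^sub>R 1 - (x + t *\<^sub>R 1)) < c"
      using t(1) unfolding T_def strictly_positive_def by blast
    have "(c + (t' - t)) *\<^sub>R 1 - (x + t' *\<^sub>R 1) = c *\<^sub>R 1 - (x + t *\<^sub>R 1)"
      by (simp add: algebra_simps)
    then have "norm ((c + (t' - t)) *\<^sub>R 1 - (x + t' *\<^sub>R 1)) < c + (t' - t)"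
      using c t by (simp only:)
    then show ?thesis using c t sa
      by (auto simp: T_def strictly_positive_def star_add star_scaleR intro!: exI [of _ "c + (t' - t)"])
  qed
  have "norm x + 1 \<in> T"
    unfolding T_def strictly_positive_def
    by (auto simp: star_add star_scaleR sa intro!: add_nonneg_pos exI [of _ "norm x + 1"])
  then have ne: "T \<noteq> {}" by auto
  have bdd: "bdd_below T" by (auto simp: T_def)
  define m where "m = Inf T"
  have m0: "0 \<le> m" unfolding m_def using ne by (intro cInf_greatest) (auto simp: T_def)
  define z where "z = x + m *\<^sub>R 1"
  \<comment> \<open>If \<open>m > 0\<close>, then \<open>-m\<close> lies outside the spectrum of
    \<open>x\<close>; for \<open>m = 0\<close> this is the assumption on \<open>x\<close>.\<close>
  have "invertible_elt z"
  proof (cases "m = 0")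
    case False
    then have "complex_of_real (- m) \<notin> complex_of_real ` {0..}"
      using m0 by (auto simp del: of_real_minus)
    then have "invertible_elt (x - complex_of_real (- m) *\<^sub>C 1)"
      using pos by (auto simp: positive_elt_def alg_spectrum_def)
    then show ?thesis unfolding z_def by (simp flip: scaleR_scaleC del: of_real_minus)
  qed (use inv in \<open>simp add: z_def\<close>)
  then obtain y where y: "z * y = 1" "y * z = 1" "star y = y"
    using sa by (metis invertible_eltE z_def star_add star_scaleR star_1)
  \<comment> \<open>For \<open>a = d\<close> and \<open>a = -d\<close>, the factor
    \<open>1 + a y\<close> of \<open>z + a = z (1 + a y)\<close> is then within distance less than 1
    of 1.\<close>
  define d where "d = 1 / (norm y + 1)"
  have d: "d > 0" "d * norm y < 1" by (simp_all add: d_def add_nonneg_pos)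
  have near: "strictly_positive (1 + a *\<^sub>R y)" if "\<bar>a\<bar> = d" for a
    unfolding strictly_positive_def using d that y(3)
    by (intro conjI exI [of _ 1]) (auto simp: star_add star_scaleR)
  have shift: "z + a *\<^sub>R 1 = z * (1 + a *\<^sub>R y)" for a by (simp add: algebra_simps y)
  have zm: "z * (1 + a *\<^sub>R y) = (1 + a *\<^sub>R y) * z" for a by (simp add: algebra_simps y)
  \<comment> \<open>As \<open>m + d\<close> exceeds the infimum, \<open>z + d\<close> is strictly
    positive. Dividing by \<open>1 + d y\<close> gives this for \<open>z\<close>, and multiplying by
    \<open>1 - d y\<close> then gives it for \<open>z - d\<close>.\<close>
  obtain t where t: "t \<in> T" "t < m + d"
    using cInf_less_iff [OF ne bdd, of "m + d"] d by (auto simp: m_def)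
  then have "m + d \<in> T" using up less_imp_le by blast
  then have zd: "strictly_positive (z + d *\<^sub>R 1)"
    by (simp add: T_def z_def algebra_simps)
  obtain q where q: "(1 + d *\<^sub>R y) * q = 1" "q * (1 + d *\<^sub>R y) = 1"
      "\<And>v. v * (1 + d *\<^sub>R y) = (1 + d *\<^sub>R y) * v \<Longrightarrow> v * q = q * v"
    using strictly_positive_invertible [OF near [of d]] d by (metis invertible_eltE abs_of_pos)
  have "strictly_positive q"
    using strictly_positive_inverse [OF near q(1,2)] d by simp
  moreover have "(z + d *\<^sub>R 1) * q = q * (z + d *\<^sub>R 1)"
    using q(3) [OF zm] by (simp add: algebra_simps)
  ultimately have "strictly_positive ((z + d *\<^sub>R 1) * q)"
    by (intro strictly_positive_mult zd)
  then have z_sp: "strictly_positive z"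
    unfolding shift using q by (simp add: mult.assoc)
  have "strictly_positive (z + (- d) *\<^sub>R 1)"
    unfolding shift using d by (intro strictly_positive_mult z_sp near zm) auto
  then have z_sp': "strictly_positive (x + (m - d) *\<^sub>R 1)"
    unfolding z_def by (simp add: algebra_simps)
  have "m = 0"
  proof (rule ccontr)
    assume "m \<noteq> 0"
    \<comment> \<open>If \<open>m - d\<close> is negative, it is no admissible shift, but then
      \<open>x\<close> itself is strictly positive, so the shift 0 undercuts
      \<open>m\<close>.\<close>
    have "max 0 (m - d) \<in> T"
    proof (cases "0 \<le> m - d")
      case True
      then show ?thesis using z_sp' by (simp add: T_def)
    next
      case False
      obtain c where c: "c > 0" "norm (c *\<^sub>R 1 - (x + (m - d) *\<^sub>R 1)) < c"
        using z_sp' unfolding strictly_positive_def by blast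
      have "(c + (d - m)) *\<^sub>R 1 - x = c *\<^sub>R 1 - (x + (m - d) *\<^sub>R 1)"
        by (simp add: algebra_simps)
      then have "norm ((c + (d - m)) *\<^sub>R 1 - x) < c + (d - m)"
        using c False by (simp only:)
      then have "strictly_positive x"
        using c False sa by (auto simp: strictly_positive_def intro!: exI [of _ "c + (d - m)"])
      then show ?thesis using False by (simp add: T_def)
    qed
    then have "m \<le> max 0 (m - d)" unfolding m_def by (rule cInf_lower [OF _ bdd])
    then show False using m0 d \<open>m \<noteq> 0\<close> by (simp add: max_def split: if_splits)
  qed
  then show ?thesis using z_sp by (simp add: z_def)
qed

text \<open>The point is uniqueness, for \<open>THE\<close>. Another positive root \<open>y\<close>
  is invertible, hence strictly positive, and commutes with \<open>s\<close>. So
  \<open>u = y s\<^sup>-\<^sup>1\<close> is positive with \<open>u\<^sup>2 = 1\<close>; as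
  \<open>u + 1\<close> is invertible, \<open>u = 1\<close>.\<close>

lemma alg_sqrt_strictly_positive:
  fixes x :: "'a::cstar_algebra"
  assumes "strictly_positive x"
  shows "strictly_positive (alg_sqrt x)" "alg_sqrt x * alg_sqrt x = x"
proof -
  from strictly_positive_sqrt [OF assms] obtain s where
    s: "strictly_positive s" "s * s = x" "\<And>z. z * x = x * z \<Longrightarrow> z * s = s * z" by blast
  obtain q where q: "s * q = 1" "q * s = 1" "\<And>z. z * s = s * z \<Longrightarrow> z * q = q * z"
    using strictly_positive_invertible [OF s(1)] by (metis invertible_eltE)
  have uniq: "y = s" if y: "positive_elt y" "y * y = x" for y
  proof -
    obtain x' where "x * x' = 1" "x' * x = 1"
      using strictly_positive_invertible [OF assms] by (rule invertible_eltE)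
    then have "invertible_elt y"
      using y(2) by (intro invertible_eltI [of y "y * x'" "x' * y"]) (simp add: mult.assoc [symmetric], simp add: mult.assoc)
    then have y_sp: "strictly_positive y"
      using y(1) by (rule positive_invertible_imp_strictly_positive [rotated])
    have "y * s = s * y" using s(3) y(2) by (metis mult.assoc)
    then have yq: "y * q = q * y" by (rule q(3))
    define u where "u = y * q"
    have "strictly_positive u" unfolding u_def
      using strictly_positive_inverse [OF s(1) q(1,2)] by (intro strictly_positive_mult y_sp yq)
    then have "positive_elt u" by (rule strictly_positive_imp_positive)
    moreover have "complex_of_real (- 1) \<notin> complex_of_real ` {0..}"
      by (auto simp del: of_real_minus)
    ultimately have "invertible_elt (u - complex_of_real (- 1) *\<^sub>C 1)"
      by (auto simp: positive_elt_def alg_spectrum_def)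
    then have "invertible_elt (u + 1)"
      by (simp flip: scaleR_scaleC del: of_real_minus)
    then obtain p where p: "(u + 1) * p = 1" by (rule invertible_eltE)
    have "u * u = (y * y) * (q * q)" unfolding u_def by (metis yq mult.assoc)
    also have "\<dots> = s * (s * q) * q" using y(2) s(2) by (simp flip: mult.assoc)
    finally have "u * u = 1" using q by simp
    then have "(u - 1) * (u + 1) = 0" by (simp add: algebra_simps)
    then have "u = 1" using p by (metis mult.assoc mult_1_right mult_zero_left right_minus_eq)
    then show ?thesis unfolding u_def using q by (metis mult.assoc mult_1_left mult_1_right)
  qed
  have "alg_sqrt x = s" unfolding alg_sqrt_def
    using s(1,2) uniq strictly_positive_imp_positive by (intro the_equality) auto
  then show "strictly_positive (alg_sqrt x)" "alg_sqrt x * alg_sqrt x = x"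
    using s(1,2) by simp_all
qed

section \<open>Moore--Penrose inverses and range projections\<close>

text \<open>\<open>1 - 2 p\<close> is a self-adjoint unitary, so \<open>p\<close> has distance 1/2
  from the scalar 1/2; centres and radii of the discs add up.\<close>

lemma norm_scalar_minus_add_projection:
  fixes x p :: "'a::cstar_algebra"
  assumes p: "is_projection p" and x: "norm (c *\<^sub>R 1 - x) \<le> c"
  shows "norm ((c + 1/2) *\<^sub>R 1 - (x + p)) \<le> c + 1/2"
proof -
  define h where "h = (1/2) *\<^sub>R 1 - p"
  have "star h = h" "h * h = (1/4) *\<^sub>R 1"
    using p by (simp_all add: h_def is_projection_def star_diff star_scaleR algebra_simps
        flip: scaleR_add_left)
  then have "(norm h)\<^sup>2 = (1/2)\<^sup>2"
    using cstar_identity [of h] by (simp add: power2_eq_square)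
  then have h: "norm h = 1/2"
    by (rule power2_eq_imp_eq) auto
  have "(c + 1/2) *\<^sub>R 1 - (x + p) = (c *\<^sub>R 1 - x) + h"
    by (simp add: h_def algebra_simps)
  then show ?thesis
    using norm_triangle_ineq [of "c *\<^sub>R 1 - x" h] x h by (simp only:)
qed

lemma norm_scalar_minus_sum_projections:
  fixes p :: "'i \<Rightarrow> 'a::cstar_algebra"
  assumes "finite S" "\<And>i. i \<in> S \<Longrightarrow> is_projection (p i)"
  shows "norm ((card S / 2) *\<^sub>R 1 - (\<Sum>i\<in>S. p i)) \<le> card S / 2"
  using assms
proof (induction S)
  case (insert j S)
  have "real (card (insert j S)) / 2 = card S / 2 + 1/2"
    using insert by (simp add: add_divide_distrib)
  then show ?case
    using norm_scalar_minus_add_projection [of "p j" "card S / 2" "\<Sum>i\<in>S. p i"] insert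
    by (simp only: sum.insert add.commute [of "p j"] insert_iff simp_thms)
qed simp

lemma is_projection_diff_1: "is_projection p \<Longrightarrow> is_projection (1 - p)"
  unfolding is_projection_def by (simp add: star_diff algebra_simps)

text \<open>\<open>f\<close> also commutes with the inverses of \<open>a\<close> and
  \<open>u\<close>, so the element is block diagonal and can be inverted blockwise.\<close>

lemma invertible_elt_decompose:
  fixes a u f :: "'a::cstar_algebra"
  assumes f: "f * f = f" and com: "f * a = a * f" "f * u = u * f"
    and inv: "invertible_elt a" "invertible_elt u"
  shows "invertible_elt (a * f + u * (1 - f))"
proof -
  have prod: "(a * f + u * (1 - f)) * (q * f + v * (1 - f)) = 1"
    if "a * q = 1" "u * v = 1" "f * q = q * f" "f * v = v * f" for a u q v
  proof -
    have *: "f * (q * f) = q * f" "f * (v * (1 - f)) = 0"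
      using that(3,4) f by (metis mult.assoc) (simp add: that(4) f right_diff_distrib mult.assoc flip: mult.assoc [of f v])
    then have "(1 - f) * (q * f) = 0" "(1 - f) * (v * (1 - f)) = v * (1 - f)"
      by (simp_all add: left_diff_distrib)
    with * have "(a * f + u * (1 - f)) * (q * f + v * (1 - f)) = a * (q * f) + u * (v * (1 - f))"
      by (simp only: distrib_left distrib_right mult.assoc) simp
    then show ?thesis using that by (simp add: cancel_inverse_left)
  qed
  obtain q where q: "a * q = 1" "q * a = 1" "f * q = q * f"
    using inv(1) com(1) by (metis invertible_eltE)
  obtain v where v: "u * v = 1" "v * u = 1" "f * v = v * f"
    using inv(2) com(2) by (metis invertible_eltE)
  show ?thesis
    by (rule invertible_eltI [of _ "q * f + v * (1 - f)" "q * f + v * (1 - f)"])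
       (use prod q v com in blast)+
qed

text \<open>For \<open>c\<close> outside \<open>[0,\<infinity>)\<close>, \<open>k f - c\<close> is
  block diagonal with the invertible blocks \<open>k - c\<close> on \<open>f\<close> and
  \<open>-c\<close> on \<open>1 - f\<close>.\<close>

lemma positive_elt_mult_projection:
  fixes k :: "'a::cstar_algebra"
  assumes k: "positive_elt k" and f: "is_projection f" and kf: "k * f = f * k"
  shows "positive_elt (k * f)"
  unfolding positive_elt_def alg_spectrum_def
proof (intro conjI subsetI)
  show "star (k * f) = k * f"
    using k f kf by (simp add: positive_elt_def is_projection_def star_mult)
  fix c assume c: "c \<in> {c. \<not> invertible_elt (k * f - c *\<^sub>C 1)}"
  show "c \<in> complex_of_real ` {0..}"
  proof (rule ccontr)
    assume nc: "c \<notin> complex_of_real ` {0..}"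
    then have "c \<noteq> 0" by force
    have "k * f - c *\<^sub>C 1 = (k - c *\<^sub>C 1) * f + ((- c) *\<^sub>C 1) * (1 - f)"
      by (simp add: algebra_simps mult_scaleC_left scaleC_diff_right scaleC_minus_left)
    also have "invertible_elt \<dots>"
    proof (rule invertible_elt_decompose)
      show "invertible_elt (k - c *\<^sub>C 1)"
        using nc k by (auto simp: positive_elt_def alg_spectrum_def)
      show "invertible_elt ((- c) *\<^sub>C (1::'a))"
        using \<open>c \<noteq> 0\<close> by (intro invertible_elt_scaleC invertible_eltI [of 1 1 1]) auto
      show "f * f = f" using f by (simp add: is_projection_def)
    qed (simp_all add: kf right_diff_distrib left_diff_distrib mult_scaleC_left mult_scaleC_right)
    finally have "invertible_elt (k * f - c *\<^sub>C 1)" .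
    then show False using c by simp
  qed
qed

text \<open>Two candidates satisfy \<open>y b = b z\<close>, whence
  \<open>y = z b y = z b z = z\<close>.\<close>

lemma moore_penrose_eq:
  fixes b y :: "'a::cstar_algebra"
  assumes "positive_elt y" and y: "b * y * b = b" "y * b * y = y" "b * y = y * b"
  shows "moore_penrose b = y"
  unfolding moore_penrose_def
proof (rule the_equality)
  fix z assume z: "positive_elt z \<and> b * z * b = b \<and> z * b * z = z \<and> b * z = z * b"
  have "y * b = y * (b * z * b)" using z by metis
  also have "\<dots> = (y * b) * (z * b)" by (simp only: mult.assoc)
  also have "\<dots> = (b * y) * (b * z)" using y z by simp
  also have "\<dots> = b * z" using y(1) by (simp flip: mult.assoc)
  finally have eq: "y * b = b * z" .
  have "y = z * b * y" using y(2) eq z by metis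
  also have "\<dots> = z * (b * z)" using eq y(3) by (simp add: mult.assoc)
  also have "\<dots> = z" using z by (metis mult.assoc)
  finally show "z = y" by simp
qed (use assms in blast)

section \<open>Range projections of idempotents\<close>

text \<open>With the self-adjoint \<open>s = \<i> (e - star e)\<close>, the square of the element is
  \<open>1 + s\<^sup>2 = (s - \<i>) (s + \<i>)\<close>; both factors are invertible because
  \<open>s\<close> has real spectrum.\<close>

lemma invertible_idempotent_add_star:
  fixes e :: "'a::cstar_algebra"
  assumes "e * e = e"
  shows "invertible_elt (e + star e - 1)"
proof -
  let ?R = "e + star e - 1"
  define s where "s = \<i> *\<^sub>C (e - star e)"
  have sa: "star s = s"
    by (simp add: s_def star_scaleC star_diff star_star scaleC_minus_left scaleC_diff_right)
  have see: "star e * star e = star e" using assms by (metis star_mult)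
  have i2: "\<i> *\<^sub>C \<i> *\<^sub>C z = - z" for z :: 'a
    using scaleC_minus_left [of 1 z] by (simp add: scaleC_scaleC scaleC_1)
  have "s * s = - ((e - star e) * (e - star e))"
    by (simp add: s_def mult_scaleC_left mult_scaleC_right i2)
  also have "\<dots> = ?R * ?R - 1"
    by (simp add: algebra_simps assms see)
  finally have "?R * ?R = s * s + 1" by simp
  also have "\<dots> = (s - \<i> *\<^sub>C 1) * (s - (- \<i>) *\<^sub>C 1)"
    by (simp add: algebra_simps mult_scaleC_left mult_scaleC_right scaleC_minus_left
        scaleC_add_right scaleC_diff_right i2)
  also have "invertible_elt \<dots>"
    by (intro invertible_elt_mult invertible_elt_selfadjoint_minus sa) auto
  finally obtain y where "?R * ?R * y = 1" "y * (?R * ?R) = 1"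
    by (rule invertible_eltE)
  then show ?thesis
    by (intro invertible_eltI [of _ "?R * y" "y * ?R"]) (simp_all add: mult.assoc)
qed

text \<open>\<open>R = e + star e - 1\<close> intertwines \<open>e\<close> and
  \<open>star e\<close>: \<open>e R = e (star e) = R (star e)\<close>. So does its inverse
  \<open>y\<close>, which makes \<open>F = e y\<close> self-adjoint, and \<open>e y e = e\<close>
  makes it idempotent.\<close>

lemma range_projection_of_idempotent:
  fixes e :: "'a::cstar_algebra"
  assumes ee: "e * e = e"
  obtains F where "is_projection F" "F * e = e" "e * F = F"
proof -
  let ?R = "e + star e - 1"
  obtain y where y: "?R * y = 1" "y * ?R = 1" "star ?R = ?R \<Longrightarrow> star y = y"
    using invertible_idempotent_add_star [OF ee] by (metis invertible_eltE)
  have sy: "star y = y"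
    by (rule y(3)) (simp add: star_add star_diff star_star)
  have see: "star e * star e = star e" using ee by (metis star_mult)
  have eR: "e * ?R = e * star e" "?R * star e = e * star e"
    by (simp_all add: algebra_simps ee see)
  have Re: "?R * e = star e * e" "star e * ?R = star e * e"
    by (simp_all add: algebra_simps ee see)
  have "star e * y = y * ?R * star e * y" using y(2) by simp
  also have "\<dots> = y * e * (?R * y)" using eR by (simp only: mult.assoc) (metis mult.assoc)
  finally have sey: "star e * y = y * e" using y(1) by simp
  have "e * y = y * ?R * e * y" using y(2) by simp
  also have "\<dots> = y * star e * (?R * y)" using Re by (simp only: mult.assoc) (metis mult.assoc)
  finally have ye: "e * y = y * star e" using y(1) by simp
  have idem: "e * y * e = e"
  proof -
    have "e * y * e = e * (star e * y)" by (simp add: sey mult.assoc)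
    also have "\<dots> = e * (?R * y)" using eR(1) by (metis mult.assoc)
    finally show ?thesis using y(1) by simp
  qed
  have "is_projection (e * y)"
    unfolding is_projection_def
  proof
    show "star (e * y) = e * y" by (metis star_mult sy ye)
    show "e * y * (e * y) = e * y" using idem by (simp flip: mult.assoc)
  qed
  moreover have "e * y * e = e" by (rule idem)
  moreover have "e * (e * y) = e * y" using ee by (simp flip: mult.assoc)
  ultimately show thesis by (rule that)
qed

section \<open>Complete tuples\<close>

text \<open>\<open>is_direct_sum\<close> speaks of extensional families; restriction to
  \<open>S\<close> carries its uniqueness over to arbitrary ones.\<close>

lemma direct_sum_components_unique:
  assumes "is_direct_sum S V" "\<And>i. i \<in> S \<Longrightarrow> u i \<in> V i" "\<And>i. i \<in> S \<Longrightarrow> v i \<in> V i"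
    and "(\<Sum>i\<in>S. u i) = (\<Sum>i\<in>S. v i)" "i \<in> S"
  shows "u i = v i"
proof -
  have "restrict u S \<in> (\<Pi>\<^sub>E i\<in>S. V i)" "restrict v S \<in> (\<Pi>\<^sub>E i\<in>S. V i)"
    using assms by auto
  moreover have "(\<Sum>i\<in>S. u i) = (\<Sum>i\<in>S. restrict u S i)" "(\<Sum>i\<in>S. u i) = (\<Sum>i\<in>S. restrict v S i)"
    using assms by (simp_all cong: sum.cong)
  ultimately have "restrict u S = restrict v S"
    using assms(1) unfolding is_direct_sum_def by blast
  then show ?thesis using assms(5) by (metis restrict_apply')
qed

text \<open>The idempotents are the components of 1.\<close>

lemma complete_tuple_idempotents:
  fixes P :: "nat \<Rightarrow> 'a::cstar_algebra"
  assumes "complete_tuple n P"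
  obtains E where "(\<Sum>i=1..n. E i) = 1"
    "\<And>i. i \<in> {1..n} \<Longrightarrow> P i * E i = E i"
    "\<And>i j. i \<in> {1..n} \<Longrightarrow> j \<in> {1..n} \<Longrightarrow> E i * P j = (if i = j then P j else 0)"
proof -
  let ?V = "\<lambda>i. range (\<lambda>x. P i * x)"
  have ds: "is_direct_sum {1..n} ?V" and pr: "\<And>i. i \<in> {1..n} \<Longrightarrow> is_projection (P i)"
    using assms by (auto simp: complete_tuple_def nontrivial_projection_def)
  then obtain E where E: "\<And>i. i \<in> {1..n} \<Longrightarrow> E i \<in> ?V i" "(\<Sum>i=1..n. E i) = 1"
    unfolding is_direct_sum_def by (metis PiE_mem)
  have "P i * E i = E i" if i: "i \<in> {1..n}" for i
  proof -
    obtain x where "E i = P i * x" using E(1) [OF i] by auto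
    then show ?thesis using pr [OF i] by (simp add: is_projection_def flip: mult.assoc)
  qed
  \<comment> \<open>Both sides are components of \<open>P j\<close>: one family comes from
    multiplying the decomposition of 1 by \<open>P j\<close>, the other has \<open>P j\<close>
    itself as its only nonzero member.\<close>
  moreover have "E i * P j = (if i = j then P j else 0)"
    if i: "i \<in> {1..n}" and j: "j \<in> {1..n}" for i j
  proof (rule direct_sum_components_unique [OF ds _ _ _ i])
    fix k assume k: "k \<in> {1..n}"
    obtain x where "E k = P k * x" using E(1) [OF k] by auto
    then show "E k * P j \<in> ?V k" by (auto simp: mult.assoc)
    show "(if k = j then P j else 0) \<in> ?V k"
      by (auto intro: range_eqI [of _ _ 0] range_eqI [of _ _ 1])
  next
    have "(\<Sum>k=1..n. E k * P j) = P j" using E(2) by (simp flip: sum_distrib_right)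
    also have "\<dots> = (\<Sum>k=1..n. if k = j then P j else 0)" using j by simp
    finally show "(\<Sum>k=1..n. E k * P j) = (\<Sum>k=1..n. if k = j then P j else 0)" .
  qed
  ultimately show thesis using E(2) that by blast
qed

text \<open>Positivity of \<open>y = F A\<^sup>-\<^sup>1 F\<close>: the inverse of \<open>y + (1 - F)\<close> is \<open>B + (1 - F)\<close>, which lies in the
  closed disc of centre and radius \<open>c + 1/2\<close>.\<close>

lemma moore_penrose_via_idempotent:
  fixes A A' B e F :: "'a::cstar_algebra"
  assumes A': "A' * A = 1" "A * A' = 1" "star A' = A'"
    and B: "B = e * A" "star B = B" "norm (c *\<^sub>R 1 - B) \<le> c"
    and F: "is_projection F" "F * e = e" "e * F = F"
  shows "moore_penrose B = F * A' * F" "B * (F * A' * F) = F" "moore_penrose B * B = F"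
proof -
  define y where "y = F * A' * F"
  have FF: "F * F = F" and sF: "star F = F" using F(1) by (simp_all add: is_projection_def)
  have FB: "F * B = B" using B(1) F(2) by (simp flip: mult.assoc)
  then have BF: "B * F = B" using B(2) sF by (metis star_mult)
  have BA': "B * A' = e" using B(1) A' by (simp add: mult.assoc)
  have By: "B * y = F"
  proof -
    have "B * y = (B * F) * A' * F" by (simp add: y_def mult.assoc)
    then show ?thesis using BF BA' F(3) by simp
  qed
  have sy: "star y = y" by (simp add: y_def star_mult sF A'(3) mult.assoc)
  have yB: "y * B = F" using arg_cong [OF By, of star] by (simp add: star_mult sy B(2) sF)
  have Fy: "F * y = y" "y * F = y" using FF by (simp_all add: y_def mult.assoc) (simp flip: mult.assoc)
  define K where "K = B + (1 - F)"
  have Ky: "K * (y + (1 - F)) = 1" "(y + (1 - F)) * K = 1"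
    by (simp_all add: K_def algebra_simps FF BF FB By yB Fy)
  have sK: "star K = K" by (simp add: K_def star_add star_diff B(2) sF)
  have "positive_elt K"
    using norm_scalar_minus_add_projection [OF is_projection_diff_1 [OF F(1)] B(3)]
    unfolding K_def [symmetric] by (rule positive_eltI [OF sK])
  moreover have "invertible_elt K" using Ky by (rule invertible_eltI)
  ultimately have "strictly_positive K" by (rule positive_invertible_imp_strictly_positive)
  then have "strictly_positive (y + (1 - F))" using Ky by (rule strictly_positive_inverse)
  then have "positive_elt (y + (1 - F))" by (rule strictly_positive_imp_positive)
  \<comment> \<open>Multiplication by \<open>F\<close> removes the summand \<open>1 - F\<close> and
    leaves \<open>y\<close>.\<close>
  then have "positive_elt ((y + (1 - F)) * F)"
    using F(1) by (rule positive_elt_mult_projection) (simp add: algebra_simps FF Fy)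
  then have "positive_elt y" by (simp add: algebra_simps FF Fy)
  then have mp: "moore_penrose B = y"
    by (rule moore_penrose_eq) (simp_all add: By yB FB Fy)
  then show "moore_penrose B = F * A' * F" "B * (F * A' * F) = F" "moore_penrose B * B = F"
    using By yB by (simp_all add: y_def)
qed

section \<open>The two formulas for the range projection\<close>

text \<open>\<open>B\<^sup>2 + C = (B e + (1 - e)) A\<close>, and the first factor has the right
  inverse \<open>y e + (1 - e)\<close>; by self-adjointness a right inverse suffices. The inverse
  \<open>H\<close> satisfies \<open>H B e = A\<^sup>-\<^sup>1 e\<close>, so writing the last factor
  of \<open>B H B\<close> as \<open>B e F\<close> yields \<open>F\<close>.\<close>

lemma range_projection_via_square:
  fixes A A' B C e F :: "'a::cstar_algebra"
  assumes A': "A' * A = 1" "A * A' = 1" "star A = A" and BC: "A = B + C"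
    and B: "B = e * A" "star B = B" and ee: "e * e = e"
    and F: "is_projection F" "F * e = e" "e * F = F"
    and y: "B * y = F" "F * y = y"
  shows "invertible_elt (B * B + C)" "F = B * alg_inverse (B * B + C) * B"
proof -
  define G where "G = B * B + C"
  have FB: "F * B = B" using B(1) F(2) by (simp flip: mult.assoc)
  then have BF: "B * F = B" using B(2) F(1) by (metis is_projection_def star_mult)
  have GA: "G = (B * e + (1 - e)) * A"
  proof -
    have "(B * e + (1 - e)) * A = B * (e * A) + (A - e * A)" by (simp add: algebra_simps)
    then show ?thesis unfolding B(1) [symmetric] by (simp add: G_def BC)
  qed
  have ey: "e * y = y" using y(2) F(3) by (metis mult.assoc)
  have "(B * e + (1 - e)) * (y * e + (1 - e))
      = B * (e * y) * e + B * (e - e * e) + (y - e * y) * e + (1 - e - (e - e * e))"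
    by (simp add: algebra_simps)
  also have "\<dots> = 1" by (simp add: ey ee y(1) F(2))
  finally have "(B * e + (1 - e)) * (y * e + (1 - e)) = 1" .
  then have GX: "G * (A' * (y * e + (1 - e))) = 1"
    unfolding GA using A'(2) by (simp add: mult.assoc cancel_inverse_left)
  have "star G = G"
    using B(2) A'(3) BC by (simp add: G_def star_add star_mult)
  then have inv: "invertible_elt G" using GX by (rule invertible_elt_selfadjointI)
  then obtain H where H: "G * H = 1" "H * G = 1" by (rule invertible_eltE)
  have "G * (A' * e) = (B * e + (1 - e)) * e"
    unfolding GA using A'(2) by (simp add: mult.assoc cancel_inverse_left)
  also have "\<dots> = B * e" by (simp add: algebra_simps ee)
  finally have HBe: "H * (B * e) = A' * e" using H(2) by (metis cancel_inverse_left)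
  have "B * H * B = B * H * (B * (e * F))" by (simp add: F(3) BF)
  also have "\<dots> = B * (H * (B * e)) * F" by (simp add: mult.assoc)
  also have "\<dots> = e * (A * A') * e * F" unfolding HBe by (simp add: B(1) mult.assoc)
  also have "\<dots> = F" by (simp add: A'(2) ee F(3))
  finally have "F = B * H * B" by simp
  moreover have "alg_inverse G = H" using H by (rule alg_inverse_eq)
  ultimately show "F = B * alg_inverse (B * B + C) * B" by (simp add: G_def)
  show "invertible_elt (B * B + C)" using inv by (simp add: G_def)
qed

lemma corner_inverse_eq:
  fixes x y e :: "'a::cstar_algebra"
  assumes e: "e * e = e" and x: "e * x * e = x" and y: "e * y * e = y" and xy: "x * y = e" "y * x = e"
  shows "corner_invertible e x" "corner_inverse e x = y"
proof -
  have mem: "x \<in> corner e" "y \<in> corner e" unfolding corner_def using x y by (metis rangeI)+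
  then show "corner_invertible e x" unfolding corner_invertible_def using xy by blast
  show "corner_inverse e x = y" unfolding corner_inverse_def
  proof (rule the_equality)
    fix z assume z: "z \<in> corner e \<and> x * z = e \<and> z * x = e"
    then have "e * z = z" "y * e = y" using e y by (auto simp: corner_def mult.assoc) (metis mult.assoc)+
    then show "z = y" using z xy by (metis mult.assoc)
  qed (use mem xy in blast)
qed

text \<open>The inverse of \<open>Q\<^sub>0 A Q\<^sub>0\<close> in the corner is \<open>A\<^sup>-\<^sup>1\<^sup>/\<^sup>2 F A\<^sup>-\<^sup>1\<^sup>/\<^sup>2\<close>.\<close>

lemma corner_inverse_via_sqrt:
  fixes A S T B e F :: "'a::cstar_algebra"
  assumes S: "S * S = A" "S * T = 1" "T * S = 1" "star T = T"
    and B: "B = e * A" "star B = B" and ee: "e * e = e"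
    and F: "is_projection F" "F * e = e" "e * F = F"
    and Q: "Q = T * B * T"
  shows "corner_invertible Q (Q * A * Q)" "F = S * corner_inverse Q (Q * A * Q) * S"
proof -
  define A' where "A' = T * T"
  have A': "A * A' = 1" by (simp add: A'_def mult.assoc cancel_inverse_left S flip: S(1))
  have sA': "star A' = A'" by (simp add: A'_def star_mult S(4))
  have sF: "star F = F" and FF: "F * F = F" using F(1) by (simp_all add: is_projection_def)
  have FB: "F * B = B" using B(1) F(2) by (simp flip: mult.assoc)
  have BA': "B * A' = e" using B(1) A' by (simp add: mult.assoc)
  have TAT: "T * A * T = 1" by (simp add: mult.assoc cancel_inverse_left S flip: S(1))
  have sQ: "star Q = Q" by (simp add: Q star_mult S(4) B(2) mult.assoc)
  have QQ: "Q * Q = Q"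
  proof -
    have "Q * Q = T * (B * A') * B * T" by (simp add: Q A'_def mult.assoc)
    then show ?thesis unfolding BA' using ee B(1) by (simp add: Q mult.assoc) (metis mult.assoc)
  qed
  define X where "X = T * F * T"
  have sX: "star X = X" by (simp add: X_def star_mult S(4) sF mult.assoc)
  have QX: "Q * X = X"
  proof -
    have "Q * X = T * (B * A') * F * T" by (simp add: Q X_def A'_def mult.assoc)
    then show ?thesis unfolding BA' using F(3) by (simp add: X_def mult.assoc)
  qed
  have XQ: "X * Q = X" using arg_cong [OF QX, of star] by (simp add: star_mult sX sQ)
  define Y where "Y = Q * A * Q"
  have "Y = T * B * (T * A * T) * B * T" by (simp add: Y_def Q mult.assoc)
  then have Y: "Y = T * B * B * T" by (simp add: TAT)
  \<comment> \<open>This is the adjoint of \<open>B A\<^sup>-\<^sup>1 F = e F = F\<close>.\<close>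
  have FA'B: "F * A' * B = F"
  proof -
    have "A' * B = star e" using arg_cong [OF BA', of star] by (simp add: star_mult sA' B(2))
    then show ?thesis using arg_cong [OF F(3), of star] by (simp add: star_mult sF mult.assoc)
  qed
  have "X * Y = T * (F * A' * B) * B * T" by (simp add: Y X_def A'_def mult.assoc)
  then have XY: "X * Y = Q" unfolding FA'B by (simp add: Q FB mult.assoc)
  have sA: "star A = A"
    by (metis A' sA' S(1) S(2) S(3) star_mult star_1 mult.assoc mult_1_left mult_1_right A'_def)
  have sY: "star Y = Y" by (simp add: Y_def star_mult sQ sA mult.assoc)
  have YX: "Y * X = Q" using arg_cong [OF XY, of star] by (simp add: star_mult sX sY sQ)
  have "Q * Y * Q = Y" "Q * X * Q = X"
    using QQ by (simp_all add: QX XQ Y_def mult.assoc) (simp flip: mult.assoc)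
  note corner = corner_inverse_eq [OF QQ this YX XY]
  then show "corner_invertible Q (Q * A * Q)" by (simp add: Y_def)
  have "S * X * S = (S * T) * F * (T * S)" by (simp add: X_def mult.assoc)
  then show "F = S * corner_inverse Q (Q * A * Q) * S"
    using corner(2) S(2,3) by (simp add: Y_def)
qed

section \<open>Joins in a complete tuple\<close>

theorem proposition2p5:
  fixes n :: nat
    and P Q :: "nat \<Rightarrow> 'a::cstar_algebra"
    and A Q\<^sub>0 :: 'a
    and I J :: "nat set"
  assumes "n \<ge> 2"
    and "complete_tuple n P"
    and "A = (\<Sum>i=1..n. P i)"
    and "Q = (\<lambda>i. alg_inverse (alg_sqrt A) * P i * alg_inverse (alg_sqrt A))"
    and "I \<subseteq> {1..n}"
    and "J = {1..n} - I"
    and "Q\<^sub>0 = (\<Sum>i\<in>I. Q i)"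
  shows
    "invertible_elt A \<and>
     (\<forall>i\<in>{1..n}. is_projection (Q i)) \<and>
     (\<forall>i\<in>{1..n}. \<forall>j\<in>{1..n}. i \<noteq> j \<longrightarrow> Q i * Q j = 0) \<and>
     (\<Sum>i=1..n. Q i) = 1 \<and>
     corner_invertible Q\<^sub>0 (Q\<^sub>0 * A * Q\<^sub>0) \<and>
     proj_join P I = alg_sqrt A * corner_inverse Q\<^sub>0 (Q\<^sub>0 * A * Q\<^sub>0) * alg_sqrt A \<and>
     invertible_elt ((\<Sum>i\<in>I. P i)\<^sup>2 + (\<Sum>j\<in>J. P j)) \<and>
     proj_join P I =
       (\<Sum>i\<in>I. P i) * alg_inverse ((\<Sum>i\<in>I. P i)\<^sup>2 + (\<Sum>j\<in>J. P j)) * (\<Sum>i\<in>I. P i)"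
proof -
  have pr: "\<And>i. i \<in> {1..n} \<Longrightarrow> is_projection (P i)"
    using assms(2) by (auto simp: complete_tuple_def nontrivial_projection_def)
  then have sP: "\<And>i. i \<in> {1..n} \<Longrightarrow> star (P i) = P i" by (simp add: is_projection_def)
  obtain E where E: "(\<Sum>i=1..n. E i) = 1" "\<And>i. i \<in> {1..n} \<Longrightarrow> P i * E i = E i"
    "\<And>i j. i \<in> {1..n} \<Longrightarrow> j \<in> {1..n} \<Longrightarrow> E i * P j = (if i = j then P j else 0)"
    using complete_tuple_idempotents [OF assms(2)] by blast
  have EE: "E i * E j = (if i = j then E j else 0)" if "i \<in> {1..n}" "j \<in> {1..n}" for i j
  proof -
    have "E i * E j = E i * P j * E j" using E(2) [OF that(2)] by (simp add: mult.assoc)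
    then show ?thesis using E(2,3) that by simp
  qed
  have EA: "E i * A = P i" if "i \<in> {1..n}" for i
  proof -
    have "E i * A = (\<Sum>j=1..n. if i = j then P j else 0)"
      unfolding assms(3) sum_distrib_left using E(3) that by (intro sum.cong) auto
    then show ?thesis using that by simp
  qed
  have sA: "star A = A"
    unfolding assms(3) star_sum using sP by (intro sum.cong) auto
  have AE: "A * star (E i) = P i" if "i \<in> {1..n}" for i
    using arg_cong [OF EA [OF that], of star] sP [OF that] by (simp add: star_mult sA)
  \<comment> \<open>Only a right inverse has to be verified, \<open>A\<close> being
    self-adjoint.\<close>
  have "A * (\<Sum>i=1..n. star (E i) * E i) = (\<Sum>i=1..n. P i * E i)"
    unfolding sum_distrib_left using AE by (intro sum.cong) (auto simp flip: mult.assoc)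
  also have "\<dots> = 1" using E(1,2) by simp
  finally have invA: "invertible_elt A" using sA by (intro invertible_elt_selfadjointI)
  then obtain A' where A': "A * A' = 1" "A' * A = 1" "star A' = A'"
    using sA by (metis invertible_eltE)
  have "positive_elt A"
    unfolding assms(3) using pr sA [unfolded assms(3)]
    by (intro positive_eltI [of _ "card {1..n} / 2"] norm_scalar_minus_sum_projections) auto
  then have "strictly_positive A" using invA by (rule positive_invertible_imp_strictly_positive)
  define S where "S = alg_sqrt A"
  have S: "strictly_positive S" "S * S = A"
    using alg_sqrt_strictly_positive [OF \<open>strictly_positive A\<close>] by (simp_all add: S_def)
  then have "star S = S" by (simp add: strictly_positive_def)
  then obtain T where T: "S * T = 1" "T * S = 1" "star T = T"
    using strictly_positive_invertible [OF S(1)] by (metis invertible_eltE)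
  have Q: "Q i = T * P i * T" for i
    using alg_inverse_eq [OF T(1,2)] by (simp add: assms(4) S_def)
  have TTA: "T * T * A = 1" using T by (simp add: cancel_inverse_left mult.assoc flip: S(2))
  then have TT: "T * T = A'" using A' by (metis mult.assoc mult_1_left mult_1_right)
  have QQ: "Q i * Q j = (if i = j then Q j else 0)" if "i \<in> {1..n}" "j \<in> {1..n}" for i j
  proof -
    \<comment> \<open>\<open>P i\<close> and \<open>P j\<close> need not be orthogonal, but in
      \<open>Q i * Q j\<close> the factor \<open>T * T = A\<^sup>-\<^sup>1\<close> stands between
      them and turns \<open>P i\<close> into \<open>E i\<close>, which kills \<open>P j\<close> for
      \<open>j \<noteq> i\<close>.\<close>
    have "P i * A' = E i" using EA [OF that(1)] A'(1) by (metis mult.assoc mult_1_right)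
    moreover have "Q i * Q j = T * (P i * (T * T)) * P j * T" by (simp add: Q mult.assoc)
    ultimately have "Q i * Q j = T * (E i * P j) * T" by (simp add: TT mult.assoc)
    then show ?thesis using E(3) [OF that] by (simp add: Q)
  qed
  have sumQ: "(\<Sum>i\<in>X. Q i) = T * (\<Sum>i\<in>X. P i) * T" for X
    by (simp add: Q sum_distrib_left sum_distrib_right)
  have "(\<Sum>i=1..n. Q i) = T * A * T" by (simp add: sumQ assms(3))
  also have "\<dots> = 1" using T by (simp add: cancel_inverse_left mult.assoc flip: S(2))
  finally have Q1: "(\<Sum>i=1..n. Q i) = 1" .
  have finI: "finite I" using assms(5) finite_subset by blast
  \<comment> \<open>\<open>I\<close> may be empty; then \<open>e\<close>, \<open>B\<close> and the
    projection \<open>F\<close> below are 0.\<close>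
  define e B C where "e = (\<Sum>i\<in>I. E i)" and "B = (\<Sum>i\<in>I. P i)" and "C = (\<Sum>i\<in>J. P i)"
  have BeA: "B = e * A"
    unfolding B_def e_def sum_distrib_right using EA assms(5) by (intro sum.cong) auto
  have sB: "star B = B"
    unfolding B_def star_sum using sP assms(5) by (intro sum.cong) auto
  have "E i * e = E i" if "i \<in> I" for i
  proof -
    have "E i * e = (\<Sum>j\<in>I. if i = j then E j else 0)"
      unfolding e_def sum_distrib_left using EE [OF subsetD subsetD, OF assms(5) that assms(5)]
      by (intro sum.cong) auto
    then show ?thesis using that finI by simp
  qed
  then have ee: "e * e = e"
    unfolding e_def by (subst sum_distrib_right) (rule sum.cong, auto)
  then obtain F where F: "is_projection F" "F * e = e" "e * F = F"
    by (rule range_projection_of_idempotent)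
  have normB: "norm ((card I / 2) *\<^sub>R 1 - B) \<le> card I / 2"
    unfolding B_def using pr assms(5) finI by (intro norm_scalar_minus_sum_projections) auto
  note mp = moore_penrose_via_idempotent [OF A'(2,1,3) BeA sB normB F]
  have join: "proj_join P I = F" using mp(3) by (simp add: proj_join_def B_def)
  have ABC: "A = B + C"
    unfolding assms(3,6) B_def C_def using assms(5) by (simp add: sum.subset_diff add.commute)
  have "F * (F * A' * F) = F * A' * F"
    using F(1) by (simp add: is_projection_def flip: mult.assoc)
  note sq = range_projection_via_square [OF A'(2,1) sA ABC BeA sB ee F mp(2) this]
  have Q0: "Q\<^sub>0 = T * B * T" by (simp add: assms(7) sumQ B_def)
  note corner = corner_inverse_via_sqrt [OF S(2) T BeA sB ee F Q0]
  have "\<forall>i\<in>{1..n}. is_projection (Q i)"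
    using QQ sP by (simp add: is_projection_def) (simp add: Q star_mult T(3) mult.assoc)
  moreover have "\<forall>i\<in>{1..n}. \<forall>j\<in>{1..n}. i \<noteq> j \<longrightarrow> Q i * Q j = 0" using QQ by simp
  ultimately show ?thesis
    using invA Q1 corner sq unfolding join B_def [symmetric] C_def [symmetric] S_def
    by (simp add: power2_eq_square)
qed

end
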